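(* Let $n\geq 1$. Consider the $3\times 3$ integer matrix $$(M_3^n)^t-I_3=\begin{bmatrix} G(n-2)-1 & G(n-3) & G(n-1) \\ G(n-1) & G(n-2)-1 & G(n) \\ G(n) & G(n-1) & G(n+1)-1 \end{bmatrix},$$ and let $\alpha_3(n)=\left|\det\left((M_3^n)^t-I_3\right)\right|$. Then $\alpha_3(n)=H_3(n)\neq 0$.
   Context: $G$ is the Narayana's Cows sequence: $G(1)=G(2)=G(3)=1$ and $G(n)=G(n-1)+G(n-3)$ for $n\geq 4$, extended by $G(0)=0$, $G(-1)=0$, $G(-2)=1$, $G(-3)=0$. The matrix $M_3$ is $$M_3=\begin{bmatrix}0&0&1\\ 1&0&0\\ 0&1&1\end{bmatrix},$$ ${}^t$ denotes transpose, and $I_3$ is the identity matrix. The third Haselgrove sequence is $$H_3(n)=\left|\prod_{\ell=0}^{n-1}\left(1-\omega_\ell-\omega_\ell^3\right)\right|,\qquad \omega_\ell=e^{2\pi i\ell/n}\in\mathbb{C}.$$ *)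

theory Defs
  imports Complex_Main "Jordan_Normal_Form.Determinant"
begin

text \<open>
  Narayana's cows sequence on integer indices.  The recurrence is imposed for \<open>n \<ge> 4\<close> only;
  the values at \<open>-3, \<dots>, 0\<close> are the stated extension, and the values below
  \<open>-3\<close>, where the sequence is not defined, are set to \<open>0\<close>.
\<close>

function narayana :: "int \<Rightarrow> int" where
  "narayana n =
     (if n \<ge> 4 then narayana (n - 1) + narayana (n - 3)
      else if n \<in> {1, 2, 3} then 1
      else if n = -2 then 1
      else 0)"
  by auto
termination by (relation "measure nat") auto

declare narayana.simps [simp del]

definition M3 :: "int mat" where
  "M3 = mat_of_rows_list 3
     [[0, 0, 1],
      [1, 0, 0],
      [0, 1, 1]]"

definition alpha3 :: "nat \<Rightarrow> int" where
  "alpha3 n = \<bar>det ((M3 ^\<^sub>m n)\<^sup>T - 1\<^sub>m 3)\<bar>"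

definition omega :: "nat \<Rightarrow> nat \<Rightarrow> complex" where
  "omega n l = exp (2 * of_real pi * \<i> * of_nat l / of_nat n)"

definition haselgrove3 :: "nat \<Rightarrow> real" where
  "haselgrove3 n = cmod (\<Prod>l<n. 1 - omega n l - omega n l ^ 3)"

end

theory Submission imports Defs begin

text \<open>
  Over the complex numbers \<open>x\<^sup>n - 1 = (\<Prod>l<n. x - \<omega>\<^sub>l)\<close>, so
  \<open>det (M\<^sup>n - 1) = (\<Prod>l<n. det (M - \<omega>\<^sub>l))\<close> for every square matrix \<open>M\<close>.
  For \<open>M = M\<^sub>3\<close> each factor is \<open>1 + \<omega>\<^sup>2 - \<omega>\<^sup>3\<close>, and multiplying its conjugate by
  \<open>- \<omega>\<^sup>3\<close> gives \<open>1 - \<omega> - \<omega>\<^sup>3\<close>, so the moduli agree.  If \<open>1 - \<omega> - \<omega>\<^sup>3\<close>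
  vanished, so would \<open>1 + \<omega>\<^sup>2 - \<omega>\<^sup>3\<close>, and subtracting gives
  \<open>\<omega> + \<omega>\<^sup>2 = 0\<close>, hence \<open>\<omega> = -1\<close>, which is not a root.
\<close>

section \<open>Evaluation of polynomials at a square matrix\<close>

text \<open>Horner's scheme. The size is read off \<open>A\<close>, since the matrix type does not
  carry it.\<close>

definition mat_poly :: "'a::comm_ring_1 mat \<Rightarrow> 'a poly \<Rightarrow> 'a mat" where
  "mat_poly A p =
     fold_coeffs (\<lambda>a B. a \<cdot>\<^sub>m 1\<^sub>m (dim_row A) + A * B) p (0\<^sub>m (dim_row A) (dim_row A))"

context
  fixes A :: "'a::comm_ring_1 mat" and k :: nat
  assumes A: "A \<in> carrier_mat k k"
begin

lemma mat_poly_0: "mat_poly A 0 = 0\<^sub>m k k"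
  using A by (simp add: mat_poly_def)

lemma mat_poly_pCons: "mat_poly A (pCons a p) = a \<cdot>\<^sub>m 1\<^sub>m k + A * mat_poly A p"
proof -
  \<comment> \<open>Covers \<open>pCons 0 0 = 0\<close>, on which the fold makes no step.\<close>
  have "0 \<cdot>\<^sub>m 1\<^sub>m k + A * 0\<^sub>m k k = 0\<^sub>m k k"
    using A by (intro eq_matI) auto
  then show ?thesis
    using A by (cases "a = 0"; cases "p = 0") (simp_all add: mat_poly_def)
qed

lemma mat_poly_carrier: "mat_poly A p \<in> carrier_mat k k"
  using A by (induction p) (auto simp: mat_poly_0 mat_poly_pCons)

lemma mat_poly_pCons_0: "mat_poly A (pCons 0 p) = A * mat_poly A p"
proof -
  have "0 \<cdot>\<^sub>m 1\<^sub>m k = (0\<^sub>m k k :: 'a mat)"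
    by (intro eq_matI) auto
  moreover have "A * mat_poly A p \<in> carrier_mat k k"
    using A mat_poly_carrier by simp
  ultimately show ?thesis
    by (simp add: mat_poly_pCons)
qed

lemma mat_poly_add: "mat_poly A (p + q) = mat_poly A p + mat_poly A q"
proof (induction p q rule: poly_induct2)
  case 0
  then show ?case by (simp add: mat_poly_0)
next
  case (pCons a p b q)
  have *: "A * (mat_poly A p + mat_poly A q) = A * mat_poly A p + A * mat_poly A q"
    by (rule mult_add_distrib_mat[OF A mat_poly_carrier mat_poly_carrier])
  have "dim_row (mat_poly A p) = k" "dim_col (mat_poly A p) = k"
    "dim_row (mat_poly A q) = k" "dim_col (mat_poly A q) = k"
    using mat_poly_carrier by auto
  then show ?case
    using A
    by (simp add: mat_poly_pCons pCons.IH * del: index_mult_mat(1))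
      (intro eq_matI, auto simp: algebra_simps simp del: index_mult_mat(1))
qed

lemma mat_poly_smult: "mat_poly A (smult c p) = c \<cdot>\<^sub>m mat_poly A p"
proof (induction p)
  case 0
  then show ?case by (simp add: mat_poly_0)
next
  case (pCons a p)
  have *: "A * (c \<cdot>\<^sub>m mat_poly A p) = c \<cdot>\<^sub>m (A * mat_poly A p)"
    by (rule mult_smult_distrib[OF A mat_poly_carrier])
  have "dim_row (mat_poly A p) = k" "dim_col (mat_poly A p) = k"
    using mat_poly_carrier by auto
  then show ?case
    using A
    by (simp add: mat_poly_pCons pCons.IH * del: index_mult_mat(1))
      (intro eq_matI, auto simp: algebra_simps simp del: index_mult_mat(1))
qed

text \<open>Expand \<open>(x - c) p\<close> as \<open>x p - c p\<close> and use linearity. This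
  takes the place of general multiplicativity, as \<open>x^n - 1\<close> splits into linear
  factors.\<close>

lemma mat_poly_linear_mult:
  "mat_poly A ([:- c, 1:] * p) = (A + (- c) \<cdot>\<^sub>m 1\<^sub>m k) * mat_poly A p"
proof -
  let ?B = "mat_poly A p"
  have B: "?B \<in> carrier_mat k k" by (rule mat_poly_carrier)
  have "[:- c, 1:] * p = pCons 0 p + smult (- c) p"
    by simp
  then have "mat_poly A ([:- c, 1:] * p) = A * ?B + (- c) \<cdot>\<^sub>m ?B"
    by (simp only: mat_poly_add mat_poly_smult mat_poly_pCons_0)
  also have "\<dots> = A * ?B + ((- c) \<cdot>\<^sub>m 1\<^sub>m k) * ?B"
    using B by (subst mult_smult_assoc_mat[of _ k k _ k]) auto
  also have "\<dots> = (A + (- c) \<cdot>\<^sub>m 1\<^sub>m k) * ?B"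
    using A B by (intro add_mult_distrib_mat[symmetric]) auto
  finally show ?thesis .
qed

lemma mat_poly_1: "mat_poly A 1 = 1\<^sub>m k"
  using A by (simp add: one_pCons mat_poly_pCons mat_poly_0) (intro eq_matI, auto)

lemma mat_poly_monom: "mat_poly A (monom 1 m) = A ^\<^sub>m m"
proof (induction m)
  case 0
  then show ?case using A by (simp add: mat_poly_1)
next
  case (Suc m)
  \<comment> \<open>\<open>monom_Suc\<close> leads to a new factor on the left, whereas
    \<open>^\<^sub>m\<close> puts it on the right.\<close>
  have "A * A ^\<^sub>m m = A ^\<^sub>m m * A"
  proof (induction m)
    case 0
    then show ?case using A by simp
  next
    case (Suc m)
    have "A * (A ^\<^sub>m m * A) = A * A ^\<^sub>m m * A"
      using A by (intro assoc_mult_mat[symmetric]) auto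
    then show ?case using Suc by simp
  qed
  then show ?case
    by (simp add: monom_Suc mat_poly_pCons_0 Suc)
qed

lemma det_mat_poly_prod_linear:
  assumes "finite S"
  shows "det (mat_poly A (\<Prod>i\<in>S. [:- f i, 1:])) = (\<Prod>i\<in>S. det (A + (- f i) \<cdot>\<^sub>m 1\<^sub>m k))"
  using assms
proof (induction S)
  case empty
  then show ?case by (simp add: mat_poly_1)
next
  case (insert i S)
  have "A + (- f i) \<cdot>\<^sub>m 1\<^sub>m k \<in> carrier_mat k k"
    using A by simp
  then show ?case
    by (simp only: prod.insert[OF insert.hyps] mat_poly_linear_mult
        det_mult[OF _ mat_poly_carrier] insert.IH)
qed

end

section \<open>Roots of unity and the determinant of \<open>A^n - 1\<close>\<close>

lemma omega_eq_cis: "omega n l = cis (2 * pi * real l / real n)"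
  by (simp add: omega_def cis_conv_exp mult_ac)

text \<open>Both sides have degree at most \<open>n\<close>, the same coefficient at
  \<open>n\<close>, and vanish at all \<open>n\<close> roots of unity. Their difference thus has
  degree below \<open>n\<close> but \<open>n\<close> zeros.\<close>

lemma prod_linear_omega:
  assumes "n > 0"
  shows "(\<Prod>l<n. [:- omega n l, 1:]) = monom 1 n - 1"
proof (rule poly_eqI_degree_lead_coeff)
  have deg: "degree (\<Prod>l<n. [:- omega n l, 1:]) = n"
    by (subst degree_prod_sum_eq) auto
  have "lead_coeff (\<Prod>l<n. [:- omega n l, 1:]) = 1"
    by (simp add: lead_coeff_prod)
  then show "coeff (\<Prod>l<n. [:- omega n l, 1:]) n = coeff (monom 1 n - 1) n"
    using assms by (simp add: deg)
  show "degree (\<Prod>l<n. [:- omega n l, 1:]) \<le> n"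
    by (simp add: deg)
  show "degree (monom 1 n - 1 :: complex poly) \<le> n"
    by (intro degree_diff_le) (auto simp: degree_monom_le)
  show "card {z::complex. z ^ n = 1} \<ge> n"
    using card_roots_unity_eq[OF assms] by simp
  fix z :: complex
  assume z: "z \<in> {z. z ^ n = 1}"
  then obtain l where "l < n" "z = omega n l"
    using bij_betw_imp_surj_on[OF bij_betw_roots_unity[OF assms]]
    by (auto simp: omega_eq_cis)
  then have "poly (\<Prod>l<n. [:- omega n l, 1:]) z = 0"
    by (auto simp: poly_prod)
  then show "poly (\<Prod>l<n. [:- omega n l, 1:]) z = poly (monom 1 n - 1) z"
    using z by (simp add: poly_monom)
qed

lemma det_pow_mat_minus_one:
  fixes A :: "complex mat"
  assumes A: "A \<in> carrier_mat k k" and n: "n > 0"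
  shows "det (A ^\<^sub>m n - 1\<^sub>m k) = (\<Prod>l<n. det (A + (- omega n l) \<cdot>\<^sub>m 1\<^sub>m k))"
proof -
  have "monom 1 n - 1 = monom 1 n + smult (- 1) (1 :: complex poly)"
    by (simp only: smult_minus_left smult_1_left diff_conv_add_uminus)
  then have "mat_poly A (monom 1 n - 1) = A ^\<^sub>m n + (- 1) \<cdot>\<^sub>m 1\<^sub>m k"
    by (simp only: mat_poly_add[OF A] mat_poly_smult[OF A] mat_poly_monom[OF A] mat_poly_1[OF A])
  also have "\<dots> = A ^\<^sub>m n - 1\<^sub>m k"
    using A by (intro eq_matI) auto
  finally show ?thesis
    using det_mat_poly_prod_linear[OF A, of "{..<n}" "omega n"]
    by (simp add: prod_linear_omega[OF n])
qed

section \<open>The factors for \<open>M3\<close> on the unit circle\<close>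

lemma det_3:
  fixes A :: "'a::comm_ring_1 mat"
  assumes "A \<in> carrier_mat 3 3"
  shows "det A =
    A $$ (0,0) * (A $$ (1,1) * A $$ (2,2) - A $$ (1,2) * A $$ (2,1))
    - A $$ (1,0) * (A $$ (0,1) * A $$ (2,2) - A $$ (0,2) * A $$ (2,1))
    + A $$ (2,0) * (A $$ (0,1) * A $$ (1,2) - A $$ (0,2) * A $$ (1,1))"
proof -
  have det_2: "det B = B $$ (0,0) * B $$ (1,1) - B $$ (1,0) * B $$ (0,1)"
    if "B \<in> carrier_mat 2 2" for B :: "'a mat"
    using that
    by (subst laplace_expansion_column[OF that, of 0])
      (auto simp: cofactor_def mat_delete_def det_single numeral_2_eq_2)
  show ?thesis
    using assms
    by (subst laplace_expansion_column[OF assms, of 0])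
      (auto simp: cofactor_def mat_delete_def det_2 numeral_3_eq_3 numeral_2_eq_2 algebra_simps)
qed

lemma M3_carrier: "M3 \<in> carrier_mat 3 3"
  by (rule carrier_matI) (simp_all add: M3_def mat_of_rows_list_def)

text \<open>Up to sign this is \<open>z^3 - z^2 - 1\<close>, the characteristic polynomial of the
  Narayana recurrence.\<close>

lemma det_M3_minus:
  "det (map_mat of_int M3 + (- z) \<cdot>\<^sub>m 1\<^sub>m 3) = 1 + z ^ 2 - (z :: 'a::comm_ring_1) ^ 3"
  by (subst det_3)
    (auto simp: M3_def mat_of_rows_list_def algebra_simps power2_eq_square power3_eq_cube)

text \<open>On the unit circle \<open>cnj z\<close> is the inverse of \<open>z\<close>, so
  multiplying the conjugate by \<open>z^3\<close> reverses the order of the coefficients and leaves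
  the modulus unchanged.\<close>

lemma cmod_det_M3_minus:
  assumes "cmod z = 1"
  shows "cmod (1 + z ^ 2 - z ^ 3) = cmod (1 - z - z ^ 3)"
proof -
  have z: "z * cnj z = 1"
    using assms by (simp flip: complex_norm_square)
  have "1 - z - z ^ 3 = - (z ^ 3) * cnj (1 + z ^ 2 - z ^ 3)"
  proof -
    have "- (z ^ 3) * cnj (1 + z ^ 2 - z ^ 3) = - (z ^ 3) - z * (z * cnj z) ^ 2 + (z * cnj z) ^ 3"
      by (simp add: algebra_simps power2_eq_square power3_eq_cube)
    then show ?thesis by (simp add: z)
  qed
  then show ?thesis
    using assms by (simp only: norm_mult complex_mod_cnj norm_minus_cancel norm_power) simp
qed

lemma haselgrove_factor_nonzero:
  assumes "cmod z = 1"
  shows "1 - z - z ^ 3 \<noteq> 0"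
proof
  assume 1: "1 - z - z ^ 3 = 0"
  then have "1 + z ^ 2 - z ^ 3 = 0"
    using cmod_det_M3_minus[OF assms] by simp
  moreover have "z * (1 + z) = (1 + z ^ 2 - z ^ 3) - (1 - z - z ^ 3)"
    by (simp add: algebra_simps power2_eq_square)
  ultimately have "z * (1 + z) = 0"
    using 1 by simp
  moreover have "z \<noteq> 0"
    using assms by auto
  ultimately have "z = - 1"
    by (simp add: add_eq_0_iff)
  \<comment> \<open>At \<open>z = -1\<close> the value is 3.\<close>
  then show False using 1 by simp
qed

section \<open>Narayana numbers as entries of the powers of \<open>M3\<close>\<close>

lemma narayana_values:
  "narayana (- 3) = 0" "narayana (- 2) = 1" "narayana (- 1) = 0" "narayana 0 = 0"
  "narayana 1 = 1" "narayana 2 = 1" "narayana 3 = 1"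
  by (subst narayana.simps, simp)+

text \<open>The definition imposes the recurrence from 4 on; the values chosen at -3, ..., 0 extend
  it down to 0.\<close>

lemma narayana_rec:
  assumes "k \<ge> 0"
  shows "narayana k = narayana (k - 1) + narayana (k - 3)"
proof -
  consider "k \<ge> 4" | "k = 0" | "k = 1" | "k = 2" | "k = 3"
    using assms by linarith
  then show ?thesis
  proof cases
    case 1
    then show ?thesis
      \<comment> \<open>A single unfolding of the left-hand side; rewriting would unfold the
        right-hand side too.\<close>
      by (rule trans[OF narayana.simps if_P])
  qed (simp_all add: narayana_values)
qed

abbreviation narayana_mat :: "int \<Rightarrow> int mat" where
  "narayana_mat k \<equiv> mat_of_rows_list 3
     [[narayana (k - 2), narayana (k - 3), narayana (k - 1)],
      [narayana (k - 1), narayana (k - 2), narayana k],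
      [narayana k, narayana (k - 1), narayana (k + 1)]]"

text \<open>Each column holds three consecutive Narayana numbers, and the transpose of
  \<open>M3\<close> is the companion matrix that shifts such a triple by one. For small
  \<open>k\<close> this relies on the recurrence below 4.\<close>

lemma transpose_M3_mult_narayana_mat:
  assumes "k \<ge> 1"
  shows "M3\<^sup>T * narayana_mat k = narayana_mat (k + 1)"
proof -
  have rec: "narayana (k - 1) + narayana (k - 3) = narayana k"
    "narayana k + narayana (k - 2) = narayana (k + 1)"
    "narayana (k + 1) + narayana (k - 1) = narayana (k + 2)"
    using narayana_rec[of k] narayana_rec[of "k + 1"] narayana_rec[of "k + 2"] assms
    by (simp_all add: algebra_simps)
  have shift: "k + 1 - 1 = k" "k + 1 - 2 = k - 1" "k + 1 - 3 = k - 2" "k + 1 + 1 = k + 2"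
    by simp_all
  show ?thesis
    unfolding shift
    by (rule eq_matI)
      (auto simp: M3_def mat_of_rows_list_def scalar_prod_def atLeast0_lessThan_Suc rec
        less_Suc_eq numeral_3_eq_3 numeral_2_eq_2)
qed

lemma transpose_pow_M3: "n \<ge> 1 \<Longrightarrow> (M3 ^\<^sub>m n)\<^sup>T = narayana_mat (int n)"
proof (induction n rule: nat_induct_at_least)
  case base
  have pow: "M3 ^\<^sub>m 1 = M3" using M3_carrier by simp
  show ?case
    unfolding pow
    by (rule eq_matI) (auto simp: M3_def mat_of_rows_list_def narayana_values less_Suc_eq
        numeral_3_eq_3)
next
  case (Suc n)
  \<comment> \<open>Transposition reverses the product, so the last factor of the power comes to the
    left.\<close>
  have "(M3 ^\<^sub>m Suc n)\<^sup>T = M3\<^sup>T * narayana_mat (int n)"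
    using transpose_mult[of "M3 ^\<^sub>m n" 3 3 M3 3] M3_carrier Suc.IH by simp
  also have "\<dots> = narayana_mat (int (Suc n))"
    using transpose_M3_mult_narayana_mat[of "int n"] Suc.hyps by (simp add: ac_simps)
  finally show ?case .
qed

section \<open>Comparison of the determinant with the Haselgrove product\<close>

theorem proposition3p10:
  fixes n :: nat
  assumes "n \<ge> 1"
  shows "(M3 ^\<^sub>m n)\<^sup>T - 1\<^sub>m 3 =
      (let G = narayana; k = int n in
       mat_of_rows_list 3
         [[G (k - 2) - 1, G (k - 3),     G (k - 1)],
          [G (k - 1),     G (k - 2) - 1, G k],
          [G k,           G (k - 1),     G (k + 1) - 1]])
    \<and> real_of_int (alpha3 n) = haselgrove3 n
    \<and> haselgrove3 n \<noteq> 0"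
proof (intro conjI)
  show "(M3 ^\<^sub>m n)\<^sup>T - 1\<^sub>m 3 =
      (let G = narayana; k = int n in
       mat_of_rows_list 3
         [[G (k - 2) - 1, G (k - 3),     G (k - 1)],
          [G (k - 1),     G (k - 2) - 1, G k],
          [G k,           G (k - 1),     G (k + 1) - 1]])"
    unfolding transpose_pow_M3[OF assms] Let_def
    by (intro eq_matI) (auto simp: mat_of_rows_list_def less_Suc_eq numeral_3_eq_3)
  have cmod_omega: "cmod (omega n l) = 1" for l
    by (simp add: omega_eq_cis)
  let ?M = "map_mat complex_of_int M3"
  have M: "?M \<in> carrier_mat 3 3" using M3_carrier by simp
  \<comment> \<open>The factorisation needs complex roots of unity, so the integer matrix is
    embedded first.\<close>
  have "map_mat complex_of_int (M3 ^\<^sub>m n - 1\<^sub>m 3) = ?M ^\<^sub>m n - 1\<^sub>m 3"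
    unfolding of_int_hom.mat_hom_pow[OF M3_carrier, symmetric]
    using M3_carrier by (intro eq_matI) auto
  \<comment> \<open>The identity is symmetric, so the transpose does not affect the
    determinant.\<close>
  moreover have "(M3 ^\<^sub>m n)\<^sup>T - 1\<^sub>m 3 = (M3 ^\<^sub>m n - 1\<^sub>m 3)\<^sup>T"
    using M3_carrier by (intro eq_matI) auto
  moreover have "M3 ^\<^sub>m n - 1\<^sub>m 3 \<in> carrier_mat 3 3"
    by (intro minus_carrier_mat one_carrier_mat)
  ultimately have "complex_of_int (det ((M3 ^\<^sub>m n)\<^sup>T - 1\<^sub>m 3)) = det (?M ^\<^sub>m n - 1\<^sub>m 3)"
    by (simp only: det_transpose of_int_hom.hom_det[symmetric])
  also have "\<dots> = (\<Prod>l<n. 1 + omega n l ^ 2 - omega n l ^ 3)"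
    using assms by (simp only: det_pow_mat_minus_one[OF M] det_M3_minus)
  finally have "cmod (complex_of_int (det ((M3 ^\<^sub>m n)\<^sup>T - 1\<^sub>m 3))) =
      (\<Prod>l<n. cmod (1 + omega n l ^ 2 - omega n l ^ 3))"
    by (simp only: prod_norm)
  \<comment> \<open>The factors agree only in modulus, hence the passage to absolute values
    beforehand.\<close>
  also have "\<dots> = haselgrove3 n"
    by (simp only: cmod_det_M3_minus[OF cmod_omega] haselgrove3_def prod_norm)
  finally show "real_of_int (alpha3 n) = haselgrove3 n"
    by (simp only: alpha3_def norm_of_int of_int_abs)
  show "haselgrove3 n \<noteq> 0"
    using haselgrove_factor_nonzero[OF cmod_omega] by (simp add: haselgrove3_def)
qed

end
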